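(* Let $(A,\succ,\prec)$ be a Leibniz-dendriform algebra and $r=\sum_i a_i\otimes b_i\in A\otimes A$ such that $r+\tau(r)$ is invariant. Then the following are equivalent: (a) $S(r)=0$; (b) $S_1(r)=0$; (c) $S_3(r)=0$; (d) $S_4(r)=0$; (e) $S(\tau(r))=0$, where $S(r)=\sum_{i,j}\big(a_i\otimes a_j\otimes (b_j\circ b_i)-a_i\otimes (b_i\odot a_j)\otimes b_j-(a_i\succ a_j)\otimes b_i\otimes b_j\big)$, $S_1(r)=\sum_{i,j}\big((a_i\odot a_j)\otimes b_i\otimes b_j+a_i\otimes a_j\otimes(b_i\circ b_j)+a_i\otimes(b_i\succ a_j)\otimes b_j\big)$, $S_3(r)=\sum_{i,j}\big(a_j\otimes(a_i\odot b_j)\otimes b_i+a_j\otimes a_i\otimes(b_i\succ b_j)-(a_i\circ a_j)\otimes b_i\otimes b_j\big)$, $S_4(r)=\sum_{i,j}\big(-(a_i\odot a_j)\otimes b_j\otimes b_i+a_i\otimes(b_i\circ a_j)\otimes b_j+a_i\otimes a_j\otimes(b_i\succ b_j)\big)$, and $S(\tau(r))=\sum_{i,j}\big(b_i\otimes b_j\otimes(a_j\circ a_i)-b_i\otimes(a_i\odot b_j)\otimes a_j-(b_i\succ b_j)\otimes a_i\otimes a_j\big)$.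
   Context: $\tau(a\otimes b)=b\otimes a$, $I$ is the identity. A Leibniz-dendriform algebra is a vector space $A$ with bilinear operations $\succ,\prec$ such that, with $x\circ y:=x\succ y+x\prec y$, for all $x,y,z$: $(x\circ y)\succ z=x\succ(y\succ z)-y\succ(x\succ z)$, $y\prec(x\circ z)+(x\succ y)\prec z=x\succ(y\prec z)$, $x\prec(y\circ z)=(x\prec y)\prec z+y\succ(x\prec z)$. Write $x\odot y:=x\succ y+y\prec x$, $x\star y:=x\circ y+y\circ x$; $L_*(x)y=x*y$, $R_*(x)y=y*x$; $L_\odot:=L_\succ+R_\prec$, $L_\star:=L_\circ+R_\circ$. An element $s\in A\otimes A$ is invariant if for all $x\in A$: $(L_\odot(x)\otimes I-I\otimes R_\circ(x))s=0$ and $(L_\star(x)\otimes I-I\otimes R_\prec(x))\tau(s)=0$. *)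

theory Defs
  imports Complex_Main
begin

text \<open>A vector space over a field 'k is given by a scalar multiplication
  sc :: 'k \<Rightarrow> 'a \<Rightarrow> 'a satisfying the Vector_Spaces locale axioms.
  Tensors in A\<otimes>A and A\<otimes>A\<otimes>A are represented as finite sums of pure tensors,
  i.e. lists of pairs / triples. Scalars (signs) are absorbed into a factor.
  Such a finite sum is zero in the (algebraic) tensor product iff every
  bilinear (resp. trilinear) form A\<times>A\<rightarrow>k (resp. A\<times>A\<times>A\<rightarrow>k) vanishes on it
  (the dual of the tensor product over a field separates points).\<close>

definition lin_form :: "('k::field \<Rightarrow> 'a::ab_group_add \<Rightarrow> 'a) \<Rightarrow> ('a \<Rightarrow> 'k) \<Rightarrow> bool" where
  "lin_form sc f = Vector_Spaces.linear sc ((*)) f"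

definition bilin_form :: "('k::field \<Rightarrow> 'a::ab_group_add \<Rightarrow> 'a) \<Rightarrow> ('a \<Rightarrow> 'a \<Rightarrow> 'k) \<Rightarrow> bool" where
  "bilin_form sc f = ((\<forall>y. lin_form sc (\<lambda>x. f x y)) \<and> (\<forall>x. lin_form sc (f x)))"

definition trilin_form :: "('k::field \<Rightarrow> 'a::ab_group_add \<Rightarrow> 'a) \<Rightarrow> ('a \<Rightarrow> 'a \<Rightarrow> 'a \<Rightarrow> 'k) \<Rightarrow> bool" where
  "trilin_form sc f = ((\<forall>y z. lin_form sc (\<lambda>x. f x y z)) \<and> (\<forall>x z. lin_form sc (\<lambda>y. f x y z))
      \<and> (\<forall>x y. lin_form sc (f x y)))"

definition tensor2_zero :: "('k::field \<Rightarrow> 'a::ab_group_add \<Rightarrow> 'a) \<Rightarrow> ('a \<times> 'a) list \<Rightarrow> bool" where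
  "tensor2_zero sc ts = (\<forall>f. bilin_form sc f \<longrightarrow> (\<Sum>(x,y)\<leftarrow>ts. f x y) = 0)"

definition tensor3_zero :: "('k::field \<Rightarrow> 'a::ab_group_add \<Rightarrow> 'a) \<Rightarrow> ('a \<times> 'a \<times> 'a) list \<Rightarrow> bool" where
  "tensor3_zero sc ts = (\<forall>f. trilin_form sc f \<longrightarrow> (\<Sum>(x,y,z)\<leftarrow>ts. f x y z) = 0)"

definition bilin_op :: "('k::field \<Rightarrow> 'a::ab_group_add \<Rightarrow> 'a) \<Rightarrow> ('a \<Rightarrow> 'a \<Rightarrow> 'a) \<Rightarrow> bool" where
  "bilin_op sc m = ((\<forall>y. Vector_Spaces.linear sc sc (\<lambda>x. m x y)) \<and> (\<forall>x. Vector_Spaces.linear sc sc (m x)))"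

definition circ_op :: "('a::ab_group_add \<Rightarrow> 'a \<Rightarrow> 'a) \<Rightarrow> ('a \<Rightarrow> 'a \<Rightarrow> 'a) \<Rightarrow> 'a \<Rightarrow> 'a \<Rightarrow> 'a" where
  "circ_op sg pr x y = sg x y + pr x y"

definition odot_op :: "('a::ab_group_add \<Rightarrow> 'a \<Rightarrow> 'a) \<Rightarrow> ('a \<Rightarrow> 'a \<Rightarrow> 'a) \<Rightarrow> 'a \<Rightarrow> 'a \<Rightarrow> 'a" where
  "odot_op sg pr x y = sg x y + pr y x"

definition star_op :: "('a::ab_group_add \<Rightarrow> 'a \<Rightarrow> 'a) \<Rightarrow> ('a \<Rightarrow> 'a \<Rightarrow> 'a) \<Rightarrow> 'a \<Rightarrow> 'a \<Rightarrow> 'a" where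
  "star_op sg pr x y = circ_op sg pr x y + circ_op sg pr y x"

text \<open>sg = \<succ>, pr = \<prec>.\<close>
definition leibniz_dendriform :: "('k::field \<Rightarrow> 'a::ab_group_add \<Rightarrow> 'a) \<Rightarrow> ('a \<Rightarrow> 'a \<Rightarrow> 'a) \<Rightarrow> ('a \<Rightarrow> 'a \<Rightarrow> 'a) \<Rightarrow> bool" where
  "leibniz_dendriform sc sg pr =
    (vector_space sc \<and> bilin_op sc sg \<and> bilin_op sc pr \<and>
     (\<forall>x y z. sg (circ_op sg pr x y) z = sg x (sg y z) - sg y (sg x z)) \<and>
     (\<forall>x y z. pr y (circ_op sg pr x z) + pr (sg x y) z = sg x (pr y z)) \<and>
     (\<forall>x y z. pr x (circ_op sg pr y z) = pr (pr x y) z + sg y (pr x z)))"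

definition tau :: "('a \<times> 'a) list \<Rightarrow> ('a \<times> 'a) list" where
  "tau r = map prod.swap r"

definition invariant :: "('k::field \<Rightarrow> 'a::ab_group_add \<Rightarrow> 'a) \<Rightarrow> ('a \<Rightarrow> 'a \<Rightarrow> 'a) \<Rightarrow> ('a \<Rightarrow> 'a \<Rightarrow> 'a)
     \<Rightarrow> ('a \<times> 'a) list \<Rightarrow> bool" where
  "invariant sc sg pr s =
    (\<forall>x. tensor2_zero sc (concat (map (\<lambda>(u,v). [(odot_op sg pr x u, v), (u, - circ_op sg pr v x)]) s))
       \<and> tensor2_zero sc (concat (map (\<lambda>(u,v). [(star_op sg pr x u, v), (u, - pr v x)]) (tau s))))"

definition S_op :: "('a::ab_group_add \<Rightarrow> 'a \<Rightarrow> 'a) \<Rightarrow> ('a \<Rightarrow> 'a \<Rightarrow> 'a) \<Rightarrow> ('a \<times> 'a) list \<Rightarrow> ('a \<times> 'a \<times> 'a) list" where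
  "S_op sg pr r = concat [ [(ai, aj, circ_op sg pr bj bi), (ai, - odot_op sg pr bi aj, bj), (- sg ai aj, bi, bj)].
      (ai,bi) \<leftarrow> r, (aj,bj) \<leftarrow> r]"

definition S1_op :: "('a::ab_group_add \<Rightarrow> 'a \<Rightarrow> 'a) \<Rightarrow> ('a \<Rightarrow> 'a \<Rightarrow> 'a) \<Rightarrow> ('a \<times> 'a) list \<Rightarrow> ('a \<times> 'a \<times> 'a) list" where
  "S1_op sg pr r = concat [ [(odot_op sg pr ai aj, bi, bj), (ai, aj, circ_op sg pr bi bj), (ai, sg bi aj, bj)].
      (ai,bi) \<leftarrow> r, (aj,bj) \<leftarrow> r]"

definition S3_op :: "('a::ab_group_add \<Rightarrow> 'a \<Rightarrow> 'a) \<Rightarrow> ('a \<Rightarrow> 'a \<Rightarrow> 'a) \<Rightarrow> ('a \<times> 'a) list \<Rightarrow> ('a \<times> 'a \<times> 'a) list" where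
  "S3_op sg pr r = concat [ [(aj, odot_op sg pr ai bj, bi), (aj, ai, sg bi bj), (- circ_op sg pr ai aj, bi, bj)].
      (ai,bi) \<leftarrow> r, (aj,bj) \<leftarrow> r]"

definition S4_op :: "('a::ab_group_add \<Rightarrow> 'a \<Rightarrow> 'a) \<Rightarrow> ('a \<Rightarrow> 'a \<Rightarrow> 'a) \<Rightarrow> ('a \<times> 'a) list \<Rightarrow> ('a \<times> 'a \<times> 'a) list" where
  "S4_op sg pr r = concat [ [(- odot_op sg pr ai aj, bj, bi), (ai, circ_op sg pr bi aj, bj), (ai, aj, sg bi bj)].
      (ai,bi) \<leftarrow> r, (aj,bj) \<leftarrow> r]"

end

theory Submission
  imports Defs
begin

text \<open>Write \<open>s = r + \<tau>(r)\<close>, and let a permutation of the three tensor factors act on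
  \<open>A \<otimes> A \<otimes> A\<close>. Since \<open>s\<close> is symmetric, the two invariance conditions can also be used with the
  tensor factors exchanged, and linear combinations of the four resulting relations show
  \<open>S(\<tau>(r)) = S(r)\<close>, \<open>S\<^sub>1(r) = (12) S(r)\<close>, \<open>S\<^sub>3(r) = -(13) S(\<tau>(r))\<close> and \<open>S\<^sub>4(r) = -(23) S\<^sub>1(r)\<close>.\<close>

section \<open>Sums over finite decompositions of tensors\<close>

definition pair_sum :: "('a \<times> 'b) list \<Rightarrow> ('a \<Rightarrow> 'b \<Rightarrow> 'c) \<Rightarrow> 'c::comm_monoid_add" where
  "pair_sum p h = (\<Sum>(x, y)\<leftarrow>p. h x y)"

lemma pair_sum_Nil [simp]: "pair_sum [] h = 0"
  and pair_sum_Cons [simp]: "pair_sum ((x, y) # p) h = h x y + pair_sum p h"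
  and pair_sum_append: "pair_sum (p @ q) h = pair_sum p h + pair_sum q h"
  by (simp_all add: pair_sum_def)

lemma pair_sum_tau: "pair_sum (tau p) h = pair_sum p (\<lambda>x y. h y x)"
  by (induction p) (auto simp: tau_def)

lemma pair_sum_zero [simp]: "pair_sum p (\<lambda>x y. 0) = 0"
  by (induction p) auto

lemma pair_sum_add:
  "pair_sum p (\<lambda>x y. g x y + h x y) = pair_sum p g + pair_sum p h"
  by (induction p) (auto simp: algebra_simps)

lemma pair_sum_uminus:
  fixes h :: "'a \<Rightarrow> 'b \<Rightarrow> 'c::ab_group_add"
  shows "pair_sum p (\<lambda>x y. - h x y) = - pair_sum p h"
  by (induction p) auto

lemma pair_sum_diff:
  fixes g h :: "'a \<Rightarrow> 'b \<Rightarrow> 'c::ab_group_add"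
  shows "pair_sum p (\<lambda>x y. g x y - h x y) = pair_sum p g - pair_sum p h"
  by (induction p) auto

lemma pair_sum_swap:
  "pair_sum p (\<lambda>a b. pair_sum q (\<lambda>c d. h a b c d))
   = pair_sum q (\<lambda>c d. pair_sum p (\<lambda>a b. h a b c d))"
  by (induction p) (auto simp: pair_sum_add)

lemma pair_sum_symmetrized:
  "pair_sum (p @ tau p) (\<lambda>x y. h y x) = pair_sum (p @ tau p) h"
  by (simp add: pair_sum_append pair_sum_tau add.commute)

lemmas pair_sum_linear = pair_sum_add pair_sum_diff pair_sum_uminus

section \<open>Multilinear test forms\<close>

lemma lin_form_add: "lin_form sc f \<Longrightarrow> f (x + y) = f x + f y"
  unfolding lin_form_def linear_iff_module_hom by (rule module_hom.add)

lemma lin_form_uminus: "lin_form sc f \<Longrightarrow> f (- x) = - f x"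
  unfolding lin_form_def linear_iff_module_hom by (rule module_hom.neg)

lemma bilin_form_add:
  assumes "bilin_form sc h"
  shows "h (x + x') y = h x y + h x' y" "h x (y + y') = h x y + h x y'"
  using assms lin_form_add[of sc "\<lambda>x. h x y"] lin_form_add[of sc "h x"]
  by (auto simp: bilin_form_def)

lemma bilin_form_uminus:
  assumes "bilin_form sc h"
  shows "h (- x) y = - h x y" "h x (- y) = - h x y"
  using assms lin_form_uminus[of sc "\<lambda>x. h x y"] lin_form_uminus[of sc "h x"]
  by (auto simp: bilin_form_def)

lemma bilin_form_swap: "bilin_form sc h \<Longrightarrow> bilin_form sc (\<lambda>x y. h y x)"
  by (simp add: bilin_form_def)

lemma trilin_form_bilin_forms:
  assumes "trilin_form sc f"
  shows "bilin_form sc (f x)" "bilin_form sc (\<lambda>x. f x y)" "bilin_form sc (\<lambda>x y. f x y z)"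
  using assms by (simp_all add: trilin_form_def bilin_form_def)

lemma trilin_form_permute:
  assumes "trilin_form sc f"
  shows "trilin_form sc (\<lambda>x y z. f y x z)" "trilin_form sc (\<lambda>x y z. f z y x)"
    "trilin_form sc (\<lambda>x y z. f x z y)"
  using assms by (simp_all add: trilin_form_def)

lemma trilin_form_uminus:
  assumes "trilin_form sc f"
  shows "f (- x) y z = - f x y z" "f x (- y) z = - f x y z" "f x y (- z) = - f x y z"
  using trilin_form_bilin_forms[OF assms] bilin_form_uminus by metis+

lemma sum_list_concat_map_pair:
  "(\<Sum>t\<leftarrow>concat (map (\<lambda>(x, y). g x y) p). w t) = pair_sum p (\<lambda>x y. \<Sum>t\<leftarrow>g x y. w t)"
  by (induction p) auto

lemma sum_list_concat_map_pair_pair: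
  "(\<Sum>t\<leftarrow>concat (concat (map (\<lambda>(a, b). map (\<lambda>(c, d). g a b c d) q) p)). w t)
   = pair_sum p (\<lambda>a b. pair_sum q (\<lambda>c d. \<Sum>t\<leftarrow>g a b c d. w t))"
proof (induction p)
  case (Cons x p)
  have "(\<Sum>t\<leftarrow>concat (map (\<lambda>(c, d). g a b c d) q). w t)
      = pair_sum q (\<lambda>c d. \<Sum>t\<leftarrow>g a b c d. w t)" for a b
    by (rule sum_list_concat_map_pair)
  with Cons show ?case
    by (cases x) simp
qed simp

text \<open>Both invariance conditions have this shape, with \<open>F\<close> and \<open>G\<close>
  multiplications by a fixed element. Testing against \<open>h\<close> turns them into a rule that
  trades \<open>F\<close> in the first factor for \<open>G\<close> in the second.\<close>

lemma pair_sum_eq_of_tensor2_zero: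
  assumes "tensor2_zero sc (concat (map (\<lambda>(u, v). [(F u, v), (u, - G v)]) p))"
    and h: "bilin_form sc h"
  shows "pair_sum p (\<lambda>u v. h (F u) v) = pair_sum p (\<lambda>u v. h u (G v))"
proof -
  have "(\<Sum>(x, y)\<leftarrow>concat (map (\<lambda>(u, v). [(F u, v), (u, - G v)]) p). h x y) = 0"
    using assms unfolding tensor2_zero_def by blast
  then show ?thesis
    by (simp add: sum_list_concat_map_pair bilin_form_uminus[OF h] pair_sum_linear)
qed

context
  fixes sc :: "'k::field \<Rightarrow> 'a::ab_group_add \<Rightarrow> 'a"
    and sg pr :: "'a \<Rightarrow> 'a \<Rightarrow> 'a"
begin

text \<open>The polarization of the quadratic expression S, paired with \<open>f\<close>: the two
  copies of r become separate arguments, so that one of them can be replaced by s alone.\<close>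

definition S_eval :: "('a \<Rightarrow> 'a \<Rightarrow> 'a \<Rightarrow> 'k) \<Rightarrow> ('a \<times> 'a) list \<Rightarrow> ('a \<times> 'a) list \<Rightarrow> 'k" where
  "S_eval f p q = pair_sum p (\<lambda>a b. pair_sum q (\<lambda>c d.
     f a c (circ_op sg pr d b) - f a (odot_op sg pr b c) d - f (sg a c) b d))"

definition S1_eval :: "('a \<Rightarrow> 'a \<Rightarrow> 'a \<Rightarrow> 'k) \<Rightarrow> ('a \<times> 'a) list \<Rightarrow> 'k" where
  "S1_eval f p = pair_sum p (\<lambda>a b. pair_sum p (\<lambda>c d.
     f (odot_op sg pr a c) b d + f a c (circ_op sg pr b d) + f a (sg b c) d))"

definition S3_eval :: "('a \<Rightarrow> 'a \<Rightarrow> 'a \<Rightarrow> 'k) \<Rightarrow> ('a \<times> 'a) list \<Rightarrow> 'k" where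
  "S3_eval f p = pair_sum p (\<lambda>a b. pair_sum p (\<lambda>c d.
     f c (odot_op sg pr a d) b + f c a (sg b d) - f (circ_op sg pr a c) b d))"

definition S4_eval :: "('a \<Rightarrow> 'a \<Rightarrow> 'a \<Rightarrow> 'k) \<Rightarrow> ('a \<times> 'a) list \<Rightarrow> 'k" where
  "S4_eval f p = pair_sum p (\<lambda>a b. pair_sum p (\<lambda>c d.
     - f (odot_op sg pr a c) d b + f a (circ_op sg pr b c) d + f a c (sg b d)))"

lemma tensor3_zero_S_iff:
  "tensor3_zero sc (S_op sg pr p) \<longleftrightarrow> (\<forall>f. trilin_form sc f \<longrightarrow> S_eval f p p = 0)"
  "tensor3_zero sc (S1_op sg pr p) \<longleftrightarrow> (\<forall>f. trilin_form sc f \<longrightarrow> S1_eval f p = 0)"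
  "tensor3_zero sc (S3_op sg pr p) \<longleftrightarrow> (\<forall>f. trilin_form sc f \<longrightarrow> S3_eval f p = 0)"
  "tensor3_zero sc (S4_op sg pr p) \<longleftrightarrow> (\<forall>f. trilin_form sc f \<longrightarrow> S4_eval f p = 0)"
  by (auto simp: tensor3_zero_def S_op_def S1_op_def S3_op_def S4_op_def
      S_eval_def S1_eval_def S3_eval_def S4_eval_def
      sum_list_concat_map_pair_pair trilin_form_uminus algebra_simps)

text \<open>A relabelling: \<open>tau\<close> swaps the letters in each pair and \<open>f\<close> is
  read backwards. Only the \<circ> term also needs its two copies of \<open>p\<close>
  interchanged.\<close>

lemma S3_eval_eq: "S3_eval f p = - S_eval (\<lambda>x y z. f z y x) (tau p) (tau p)"
proof -
  have "pair_sum p (\<lambda>a b. pair_sum p (\<lambda>c d. f (circ_op sg pr a c) b d))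
      = pair_sum p (\<lambda>a b. pair_sum p (\<lambda>c d. f (circ_op sg pr c a) d b))"
    by (rule pair_sum_swap)
  then show ?thesis
    by (simp add: S3_eval_def S_eval_def pair_sum_tau pair_sum_linear)
qed

section \<open>Consequences of the invariance of s = r + \<tau>(r)\<close>

context
  fixes r :: "('a \<times> 'a) list"
  assumes inv: "invariant sc sg pr (r @ tau r)"
begin

lemma invariant_odot:
  assumes h: "bilin_form sc h"
  shows "pair_sum (r @ tau r) (\<lambda>u v. h (odot_op sg pr x u) v)
    = pair_sum (r @ tau r) (\<lambda>u v. h u (circ_op sg pr v x))"
  by (rule pair_sum_eq_of_tensor2_zero[OF _ h]) (use inv in \<open>simp only: invariant_def\<close>)

text \<open>The second condition is stated for \<tau>(s); the symmetry of s carries it over to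
  s.\<close>

lemma invariant_star:
  assumes h: "bilin_form sc h"
  shows "pair_sum (r @ tau r) (\<lambda>u v. h (star_op sg pr x u) v)
    = pair_sum (r @ tau r) (\<lambda>u v. h u (pr v x))"
proof -
  have "pair_sum (tau (r @ tau r)) (\<lambda>u v. h (star_op sg pr x u) v)
     = pair_sum (tau (r @ tau r)) (\<lambda>u v. h u (pr v x))"
    by (rule pair_sum_eq_of_tensor2_zero[OF _ h]) (use inv in \<open>simp only: invariant_def\<close>)
  then show ?thesis
    by (simp only: pair_sum_tau pair_sum_symmetrized[of r "\<lambda>u v. h (star_op sg pr x u) v"]
        pair_sum_symmetrized[of r "\<lambda>u v. h u (pr v x)"])
qed

text \<open>Since x \<star> u = x \<odot> u + u \<odot> x, subtracting \<open>invariant_odot\<close>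
  from \<open>invariant_star\<close> leaves v \<prec> x - v \<circ> x = -(v \<succ> x) in the second
  factor.\<close>

lemma invariant_odot_right:
  assumes h: "bilin_form sc h"
  shows "pair_sum (r @ tau r) (\<lambda>u v. h (odot_op sg pr u x) v)
    = - pair_sum (r @ tau r) (\<lambda>u v. h u (sg v x))"
proof -
  note expand = odot_op_def star_op_def circ_op_def bilin_form_add[OF h] pair_sum_linear
  show ?thesis
    using invariant_odot[OF h, of x] invariant_star[OF h, of x]
    unfolding expand by algebra
qed

text \<open>With the factors exchanged, \<open>invariant_star\<close> trades u \<prec> x on the left
  for x \<star> v = x \<circ> v + v \<circ> x on the right. Subtracting
  \<open>invariant_odot\<close> removes v \<circ> x and cancels u \<prec> x against part of x
  \<odot> u.\<close>

lemma invariant_circ_left: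
  assumes h: "bilin_form sc h"
  shows "pair_sum (r @ tau r) (\<lambda>u v. h u (circ_op sg pr x v))
    = - pair_sum (r @ tau r) (\<lambda>u v. h (sg x u) v)"
proof -
  note expand = odot_op_def star_op_def circ_op_def bilin_form_add[OF h] pair_sum_linear
  have "pair_sum (r @ tau r) (\<lambda>u v. h (pr u x) v)
      = pair_sum (r @ tau r) (\<lambda>u v. h u (star_op sg pr x v))"
    using invariant_star[OF bilin_form_swap[OF h], of x]
      pair_sum_symmetrized[of r "\<lambda>u v. h u (star_op sg pr x v)"]
      pair_sum_symmetrized[of r "\<lambda>u v. h (pr u x) v"]
    by simp
  then show ?thesis
    using invariant_odot[OF h, of x]
    unfolding expand by (simp add: eq_neg_iff_add_eq_0 algebra_simps)
qed

lemma invariant_odot_right':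
  assumes h: "bilin_form sc h"
  shows "pair_sum (r @ tau r) (\<lambda>u v. h u (odot_op sg pr v x))
    = - pair_sum (r @ tau r) (\<lambda>u v. h (sg u x) v)"
  using invariant_odot_right[OF bilin_form_swap[OF h], of x]
    pair_sum_symmetrized[of r "\<lambda>u v. h u (odot_op sg pr v x)"]
    pair_sum_symmetrized[of r "\<lambda>u v. h (sg u x) v"]
  by simp

lemma invariant_circ_left':
  assumes h: "bilin_form sc h"
  shows "pair_sum (r @ tau r) (\<lambda>u v. h (circ_op sg pr x u) v)
    = - pair_sum (r @ tau r) (\<lambda>u v. h u (sg x v))"
  using invariant_circ_left[OF bilin_form_swap[OF h], of x]
    pair_sum_symmetrized[of r "\<lambda>u v. h (circ_op sg pr x u) v"]
    pair_sum_symmetrized[of r "\<lambda>u v. h u (sg x v)"]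
  by simp

text \<open>The polarized values at (s, \<tau>(r)) and (r, s) agree. Expanding s leaves the mixed
  value at (r, \<tau>(r)) on both sides, so the two diagonal values agree.\<close>

lemma S_eval_tau:
  assumes f: "trilin_form sc f"
  shows "S_eval f (tau r) (tau r) = S_eval f r r"
proof -
  note bil = trilin_form_bilin_forms[OF f]
  let ?s = "r @ tau r"
  have "S_eval f ?s (tau r) = pair_sum (tau r) (\<lambda>c d. pair_sum ?s (\<lambda>u v.
      f u c (circ_op sg pr d v) - f u (odot_op sg pr v c) d - f (sg u c) v d))"
    unfolding S_eval_def by (rule pair_sum_swap)
  \<comment> \<open>The \<circ> term is moved to the first slot by
    \<open>invariant_circ_left\<close>; the \<odot> and \<succ> terms cancel by
    \<open>invariant_odot_right'\<close>.\<close>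
  also have "\<dots> = - pair_sum (tau r) (\<lambda>c d. pair_sum ?s (\<lambda>u v. f (sg d u) c v))"
    using invariant_circ_left[OF bil(2)] invariant_odot_right'[OF bil(3)]
    by (simp add: pair_sum_linear)
  also have "\<dots> = - pair_sum r (\<lambda>a b. pair_sum ?s (\<lambda>u v. f (sg a u) b v))"
    by (simp add: pair_sum_tau)
  \<comment> \<open>With s as the second copy, \<open>invariant_odot\<close> cancels the \<circ>
    term against the \<odot> term, so only the \<succ> term survives.\<close>
  also have "\<dots> = S_eval f r ?s"
    using invariant_odot[OF bil(1)]
    by (simp add: S_eval_def pair_sum_linear)
  finally show ?thesis
    by (simp add: S_eval_def pair_sum_append pair_sum_add)
qed

lemma S1_eval_eq:
  assumes f: "trilin_form sc f"
  shows "S1_eval f r = S_eval (\<lambda>x y z. f y x z) r r"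
proof -
  \<comment> \<open>The part of \<open>S1_eval\<close> without the \<circ> term. The \<circ> terms
    of the two sides differ only by interchanging the two copies of r.\<close>
  let ?D = "\<lambda>a b c d. f (odot_op sg pr a c) b d + f a (sg b c) d"
  have swap: "pair_sum r (\<lambda>a b. pair_sum r (\<lambda>c d. f a c (circ_op sg pr b d)))
      = pair_sum r (\<lambda>a b. pair_sum r (\<lambda>c d. f c a (circ_op sg pr d b)))"
    by (rule pair_sum_swap)
  have "pair_sum (r @ tau r) (\<lambda>a b. pair_sum r (\<lambda>c d. ?D a b c d))
      = pair_sum r (\<lambda>c d. pair_sum (r @ tau r) (\<lambda>a b. ?D a b c d))"
    by (rule pair_sum_swap)
  also have "\<dots> = 0"
    using invariant_odot_right[OF trilin_form_bilin_forms(3)[OF f]]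
    by (simp add: pair_sum_linear)
  \<comment> \<open>Splitting s into r and \<tau>(r) shows that swapping \<open>a\<close> and
    \<open>b\<close> in \<open>?D\<close> changes the sign of its sum; this gives the remaining two
    terms of the permuted S.\<close>
  finally have "pair_sum r (\<lambda>a b. pair_sum r (\<lambda>c d. ?D a b c d))
      = - pair_sum r (\<lambda>a b. pair_sum r (\<lambda>c d. ?D b a c d))"
    by (simp add: pair_sum_append pair_sum_tau eq_neg_iff_add_eq_0)
  with swap show ?thesis
    unfolding S1_eval_def S_eval_def by (simp add: pair_sum_linear)
qed

text \<open>The \<odot> terms cancel in \<open>S4_eval\<close> plus the permuted
  \<open>S1_eval\<close>. The other four terms form one sum with s as the second copy, which
  vanishes by \<open>invariant_circ_left'\<close>.\<close>

lemma S4_eval_eq: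
  assumes f: "trilin_form sc f"
  shows "S4_eval f r = - S1_eval (\<lambda>x y z. f x z y) r"
proof -
  have "pair_sum r (\<lambda>a b. pair_sum (r @ tau r)
      (\<lambda>c d. f a (circ_op sg pr b c) d + f a c (sg b d))) = 0"
    using invariant_circ_left'[OF trilin_form_bilin_forms(1)[OF f]]
    by (simp add: pair_sum_linear)
  then show ?thesis
    unfolding S4_eval_def S1_eval_def
    by (simp add: pair_sum_append pair_sum_tau pair_sum_linear) algebra
qed

end

end

theorem mainTheorem6:
  fixes sc :: "'k::field \<Rightarrow> 'a::ab_group_add \<Rightarrow> 'a"
    and sg pr :: "'a \<Rightarrow> 'a \<Rightarrow> 'a"
    and r :: "('a \<times> 'a) list"
  assumes "leibniz_dendriform sc sg pr"
    and "invariant sc sg pr (r @ tau r)"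
  shows "(tensor3_zero sc (S_op sg pr r) \<longleftrightarrow> tensor3_zero sc (S1_op sg pr r))
       \<and> (tensor3_zero sc (S_op sg pr r) \<longleftrightarrow> tensor3_zero sc (S3_op sg pr r))
       \<and> (tensor3_zero sc (S_op sg pr r) \<longleftrightarrow> tensor3_zero sc (S4_op sg pr r))
       \<and> (tensor3_zero sc (S_op sg pr r) \<longleftrightarrow> tensor3_zero sc (S_op sg pr (tau r)))"
proof -
  note inv = assms(2)
  have e: "tensor3_zero sc (S_op sg pr r) \<longleftrightarrow> tensor3_zero sc (S_op sg pr (tau r))"
    by (simp add: tensor3_zero_S_iff S_eval_tau[OF inv])
  \<comment> \<open>A transposition of the slots is an involution on trilinear forms, so quantifying
    over all \<open>f\<close> absorbs it; the same holds for the two equivalences that follow, where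
    the sign is harmless.\<close>
  have b: "tensor3_zero sc (S_op sg pr r) \<longleftrightarrow> tensor3_zero sc (S1_op sg pr r)"
    unfolding tensor3_zero_S_iff
    using S1_eval_eq[OF inv] trilin_form_permute(1) by fastforce
  have "tensor3_zero sc (S_op sg pr (tau r)) \<longleftrightarrow> tensor3_zero sc (S3_op sg pr r)"
    unfolding tensor3_zero_S_iff S3_eval_eq
    using trilin_form_permute(2) by fastforce
  moreover have "tensor3_zero sc (S1_op sg pr r) \<longleftrightarrow> tensor3_zero sc (S4_op sg pr r)"
    unfolding tensor3_zero_S_iff
    using S4_eval_eq[OF inv] trilin_form_permute(3) by fastforce
  ultimately show ?thesis
    using b e by blast
qed

end
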